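(* Let $X, Y$ be (real) Hausdorff locally convex topological vector spaces, let $\varphi: X\times Y\to\overline{\mathbb{R}}$ be a proper convex function, and let $G: X\rightrightarrows Y$ be a convex multifunction. Let $\mu: X\to\overline{\mathbb{R}}$, $\mu(x)=\inf\{\varphi(x,y)\mid y\in G(x)\}$, and suppose that $\mu$ is finite at $\bar x\in X$. Suppose that at least one of the following regularity conditions is satisfied: (a) $\operatorname{int}(\operatorname{gph} G)\cap \operatorname{dom}\varphi\neq\emptyset$; (b) $\varphi$ is continuous at a point $(x^0,y^0)\in\operatorname{gph} G$. Then, for every $\varepsilon\ge 0$, $$\partial_\varepsilon\mu(\bar x)=\bigcap_{\eta>0}\ \bigcap_{y\in M_\eta(\bar x)}\ \bigcup_{(\gamma_1,\gamma_2)\in\Gamma(\eta+\varepsilon)}\Big\{x^*\in X^*\ \Big|\ (x^*,0)\in\partial_{\gamma_1}\varphi(\bar x,y)+N_{\gamma_2}\big((\bar x,y);\operatorname{gph} G\big)\Big\}$$ and also $$\partial_\varepsilon\mu(\bar x)=\bigcap_{\eta>0}\ \bigcup_{y\in Y}\ \bigcup_{(\gamma_1,\gamma_2)\in\Gamma(\eta+\varepsilon)}\Big\{x^*\in X^*\ \Big|\ (x^*,0)\in\partial_{\gamma_1}\varphi(\bar x,y)+N_{\gamma_2}\big((\bar x,y);\operatorname{gph} G\big)\Big\},$$ where $M_\eta(\bar x)=\{y\in G(\bar x)\mid \varphi(\bar x,y)\le\mu(\bar x)+\eta\}$ and $\Gamma(\eta+\varepsilon)=\{(\gamma_1,\gamma_2)\mid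 \gamma_1\ge 0,\ \gamma_2\ge 0,\ \gamma_1+\gamma_2=\eta+\varepsilon\}$.
   Context: $X^*$, $Y^*$ denote the topological duals of $X$, $Y$; the dual of $X\times Y$ is identified with $X^*\times Y^*$ via $\langle (x^*,y^* ),(x,y)\rangle=\langle x^*,x\rangle+\langle y^*,y\rangle$. $\overline{\mathbb{R}}=[-\infty,+\infty]$. For $f:Z\to\overline{\mathbb{R}}$ on a Hausdorff locally convex space $Z$: $\operatorname{dom} f=\{z\mid f(z)<+\infty\}$; $f$ is proper if $\operatorname{dom} f\ne\emptyset$ and $f(z)>-\infty$ for all $z$; $f$ is convex if its epigraph $\{(z,\alpha)\in Z\times\mathbb{R}\mid \alpha\ge f(z)\}$ is convex. Continuity of a proper function at a point is understood to include that the function is finite at that point. For $f$ convex, $\bar z\in\operatorname{dom} f$ and $\varepsilon\ge 0$, the $\varepsilon$-subdifferential is $\partial_\varepsilon f(\bar z)=\{z^*\in Z^*\mid \langle z^*,z-\bar z\rangle\le f(z)-f(\bar z)+\varepsilon\ \ \forall z\in Z\}$. For a nonempty convex set $C\subset Z$, $\bar z\in C$ and $\varepsilon\ge 0$, the set of $\varepsilon$-normal directions is $N_\varepsilon(\bar z;C)=\{z^*\in Z^*\mid\langle z^*,z-\bar z\rangle\le\varepsilon\ \ \forall z\in C\}$. By convention $\partial_\varepsilon f(\bar z)=\emptyset$ if $\bar z\notin\operatorname{dom} f$ and $N_\varepsilon(\bar z;C)=\emptyset$ if $\bar z\notin C$. Sums of sets are Minkowski sums (empty if one summand is empty). For a multifunction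 $G:X\rightrightarrows Y$ (assigning to each $x\in X$ a subset $G(x)\subset Y$, possibly empty), $\operatorname{gph} G=\{(x,y)\in X\times Y\mid y\in G(x)\}$; $G$ is convex if $\operatorname{gph} G$ is a convex set. $\operatorname{int}$ denotes topological interior. Convention: $\inf\emptyset=+\infty$. *)

theory Defs
  imports "HOL-Analysis.Analysis" "HOL-Library.Function_Algebras" "HOL-Library.Set_Algebras"
begin

section \<open>Locally convex spaces\<close>

class topological_real_vector = real_vector + topological_ab_group_add +
  assumes tendsto_scaleR_Pair:
    "LIM p (nhds r \<times>\<^sub>F nhds x). fst p *\<^sub>R snd p :> nhds (r *\<^sub>R x)"

text \<open>The constant \<^const>\<open>convex\<close> is not available inside a class specification, so its
  definition is unfolded here.\<close>

class locally_convex_space = topological_real_vector +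
  assumes open_convex_nhds_zero_unfolded:
    "open U \<Longrightarrow> 0 \<in> U \<Longrightarrow>
     \<exists>V. open V \<and> (\<forall>x\<in>V. \<forall>y\<in>V. \<forall>u\<ge>0. \<forall>v\<ge>0. u + v = 1 \<longrightarrow> u *\<^sub>R x + v *\<^sub>R y \<in> V) \<and>
         0 \<in> V \<and> V \<subseteq> U"

lemma open_convex_nhds_zero:
  fixes U :: "'a::locally_convex_space set"
  shows "open U \<Longrightarrow> 0 \<in> U \<Longrightarrow> \<exists>V. open V \<and> convex V \<and> 0 \<in> V \<and> V \<subseteq> U"
  using open_convex_nhds_zero_unfolded unfolding convex_def .

class hausdorff_locally_convex_space = locally_convex_space + t2_space

instance real_normed_vector \<subseteq> hausdorff_locally_convex_space
proof
  fix r :: real and x :: 'a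
  show "LIM p (nhds r \<times>\<^sub>F nhds x). fst p *\<^sub>R snd p :> nhds (r *\<^sub>R x)"
    by (intro tendsto_scaleR filterlim_fst filterlim_snd)
next
  fix U :: "'a set"
  assume "open U" "0 \<in> U"
  then obtain e where "e > 0" "ball 0 e \<subseteq> U"
    using open_contains_ball by blast
  then have "\<exists>V. open V \<and> convex V \<and> 0 \<in> V \<and> V \<subseteq> U"
    by (intro exI[of _ "ball 0 e"]) auto
  then show "\<exists>V. open V \<and> (\<forall>x\<in>V. \<forall>y\<in>V. \<forall>u\<ge>0. \<forall>v\<ge>0. u + v = 1 \<longrightarrow> u *\<^sub>R x + v *\<^sub>R y \<in> V) \<and>
      0 \<in> V \<and> V \<subseteq> U"
    unfolding convex_def .
qed

instance prod :: (topological_monoid_add, topological_monoid_add) topological_monoid_add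
proof
  fix a b :: "'a \<times> 'b"
  have f: "((\<lambda>p. fst p) \<longlongrightarrow> a) (nhds a \<times>\<^sub>F nhds b)"
    and s: "((\<lambda>p. snd p) \<longlongrightarrow> b) (nhds a \<times>\<^sub>F nhds b)"
    by (rule filterlim_fst filterlim_snd)+
  have "((\<lambda>p. (fst (fst p) + fst (snd p), snd (fst p) + snd (snd p)))
           \<longlongrightarrow> (fst a + fst b, snd a + snd b)) (nhds a \<times>\<^sub>F nhds b)"
    by (intro tendsto_Pair tendsto_add tendsto_fst tendsto_snd f s)
  then show "LIM p (nhds a \<times>\<^sub>F nhds b). fst p + snd p :> nhds (a + b)"
    by (simp add: plus_prod_def)
qed

instance prod :: (topological_comm_monoid_add, topological_comm_monoid_add)
  topological_comm_monoid_add ..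

instance prod :: (topological_group_add, topological_group_add) topological_group_add
proof
  fix a :: "'a \<times> 'b"
  have i: "((\<lambda>p. p) \<longlongrightarrow> a) (nhds a)"
    by (rule filterlim_ident)
  have "((\<lambda>p. (- fst p, - snd p)) \<longlongrightarrow> (- fst a, - snd a)) (nhds a)"
    by (intro tendsto_Pair tendsto_minus tendsto_fst tendsto_snd i)
  then show "(uminus \<longlongrightarrow> - a) (nhds a)"
    by (simp add: uminus_prod_def[abs_def])
qed

instance prod :: (topological_ab_group_add, topological_ab_group_add)
  topological_ab_group_add ..

instance prod :: (topological_real_vector, topological_real_vector) topological_real_vector
proof
  fix r :: real and x :: "'a \<times> 'b"
  have sc: "((\<lambda>p. f p *\<^sub>R g p) \<longlongrightarrow> c *\<^sub>R y) F"
    if "(f \<longlongrightarrow> c) F" "(g \<longlongrightarrow> y) F"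
    for f c F and g :: "'d \<Rightarrow> 'c::topological_real_vector" and y
    using filterlim_compose[OF tendsto_scaleR_Pair[of c y], of "\<lambda>x. (f x, g x)" F] that
    by (simp add: filterlim_Pair)
  have f: "((\<lambda>p. fst p) \<longlongrightarrow> r) (nhds r \<times>\<^sub>F nhds x)"
    and s: "((\<lambda>p. snd p) \<longlongrightarrow> x) (nhds r \<times>\<^sub>F nhds x)"
    by (rule filterlim_fst filterlim_snd)+
  have "((\<lambda>p. (fst p *\<^sub>R fst (snd p), fst p *\<^sub>R snd (snd p)))
           \<longlongrightarrow> (r *\<^sub>R fst x, r *\<^sub>R snd x)) (nhds r \<times>\<^sub>F nhds x)"
    by (intro tendsto_Pair sc tendsto_fst tendsto_snd f s)
  then show "LIM p (nhds r \<times>\<^sub>F nhds x). fst p *\<^sub>R snd p :> nhds (r *\<^sub>R x)"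
    by (simp add: scaleR_prod_def)
qed

instance prod :: (locally_convex_space, locally_convex_space) locally_convex_space
proof
  fix U :: "('a \<times> 'b) set"
  assume "open U" "0 \<in> U"
  then obtain A B where AB: "open A" "open B" "0 \<in> A \<times> B" "A \<times> B \<subseteq> U"
    using open_prod_elim by metis
  then have "0 \<in> A" "0 \<in> B"
    by (simp_all add: zero_prod_def)
  then obtain V W where "open V" "convex V" "0 \<in> V" "V \<subseteq> A" "open W" "convex W" "0 \<in> W" "W \<subseteq> B"
    using AB open_convex_nhds_zero by metis
  then have "\<exists>V. open V \<and> convex V \<and> 0 \<in> V \<and> V \<subseteq> U"
    using AB by (intro exI[of _ "V \<times> W"]) (auto simp: zero_prod_def open_Times convex_Times)
  then show "\<exists>V. open V \<and> (\<forall>x\<in>V. \<forall>y\<in>V. \<forall>u\<ge>0. \<forall>v\<ge>0. u + v = 1 \<longrightarrow> u *\<^sub>R x + v *\<^sub>R y \<in> V) \<and>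
      0 \<in> V \<and> V \<subseteq> U"
    unfolding convex_def .
qed

instance prod :: (hausdorff_locally_convex_space, hausdorff_locally_convex_space)
  hausdorff_locally_convex_space ..


section \<open>Topological duals\<close>

definition topological_dual :: "('a::hausdorff_locally_convex_space \<Rightarrow> real) set"
  where "topological_dual = {f. linear f \<and> continuous_on UNIV f}"

text \<open>Functionals are plain functions, added pointwise via \<^theory>\<open>HOL-Library.Function_Algebras\<close>;
  Minkowski sums of sets of functionals are those of \<^theory>\<open>HOL-Library.Set_Algebras\<close>.
  The next definition is the identification of \<open>X* \<times> Y*\<close> with the dual of \<open>X \<times> Y\<close>.\<close>

definition dual_pair :: "('a \<Rightarrow> real) \<Rightarrow> ('b \<Rightarrow> real) \<Rightarrow> 'a \<times> 'b \<Rightarrow> real"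
  where "dual_pair f g = (\<lambda>(x, y). f x + g y)"

lemma bij_betw_dual_pair:
  "bij_betw (\<lambda>(f, g). dual_pair f g)
     ((topological_dual :: ('a::hausdorff_locally_convex_space \<Rightarrow> real) set) \<times>
      (topological_dual :: ('b::hausdorff_locally_convex_space \<Rightarrow> real) set))
     topological_dual"
proof (rule bij_betwI[where g = "\<lambda>h. (\<lambda>x. h (x, 0), \<lambda>y. h (0, y))"])
  show "(\<lambda>(f, g). dual_pair f g) \<in> topological_dual \<times> topological_dual \<rightarrow>
          (topological_dual :: ('a \<times> 'b \<Rightarrow> real) set)"
  proof clarify
    fix f :: "'a \<Rightarrow> real" and g :: "'b \<Rightarrow> real"
    assume f: "f \<in> topological_dual" and g: "g \<in> topological_dual"
    have "linear (dual_pair f g)"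
      using f g unfolding topological_dual_def dual_pair_def linear_iff
      by (auto simp: algebra_simps)
    moreover have "continuous_on UNIV (\<lambda>p. f (fst p) + g (snd p))"
      using f g unfolding topological_dual_def
      by (auto intro!: continuous_intros intro: continuous_on_compose2)
    ultimately show "dual_pair f g \<in> topological_dual"
      by (simp add: topological_dual_def dual_pair_def case_prod_unfold)
  qed
  show "(\<lambda>h. (\<lambda>x. h (x, 0), \<lambda>y. h (0, y))) \<in> (topological_dual :: ('a \<times> 'b \<Rightarrow> real) set) \<rightarrow>
          topological_dual \<times> topological_dual"
  proof (rule funcsetI)
    fix h :: "'a \<times> 'b \<Rightarrow> real"
    assume "h \<in> topological_dual"
    then have l: "linear h" and c: "continuous_on UNIV h"
      by (auto simp: topological_dual_def)
    have "linear (\<lambda>x. h (x, 0))" "linear (\<lambda>y. h (0, y))"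
      using linear_add[OF l, of "(_, 0)" "(_, 0)"] linear_add[OF l, of "(0, _)" "(0, _)"]
        linear_scale[OF l, of _ "(_, 0)"] linear_scale[OF l, of _ "(0, _)"]
      by (auto simp: linear_iff)
    moreover have "continuous_on UNIV (\<lambda>x. h (x, 0))" "continuous_on UNIV (\<lambda>y. h (0, y))"
      by (auto intro!: continuous_on_compose2[OF c] continuous_intros)
    ultimately show "(\<lambda>x. h (x, 0), \<lambda>y. h (0, y)) \<in> topological_dual \<times> topological_dual"
      by (simp add: topological_dual_def)
  qed
next
  fix p :: "('a \<Rightarrow> real) \<times> ('b \<Rightarrow> real)"
  assume "p \<in> topological_dual \<times> topological_dual"
  then show "(\<lambda>h. (\<lambda>x. h (x, 0), \<lambda>y. h (0, y))) (case p of (f, g) \<Rightarrow> dual_pair f g) = p"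
    by (auto simp: topological_dual_def dual_pair_def linear_0)
next
  fix h :: "'a \<times> 'b \<Rightarrow> real"
  assume "h \<in> topological_dual"
  then have l: "linear h"
    by (simp add: topological_dual_def)
  have "h (x, 0) + h (0, y) = h (x, y)" for x y
    using linear_add[OF l, of "(x, 0)" "(0, y)"] by simp
  then show "(case (\<lambda>x. h (x, 0), \<lambda>y. h (0, y)) of (f, g) \<Rightarrow> dual_pair f g) = h"
    by (auto simp: dual_pair_def)
qed


section \<open>Convex analysis of extended-real-valued functions\<close>

definition effective_domain :: "('a \<Rightarrow> ereal) \<Rightarrow> 'a set"
  where "effective_domain f = {z. f z < \<infinity>}"

definition proper_fun :: "('a \<Rightarrow> ereal) \<Rightarrow> bool"
  where "proper_fun f \<longleftrightarrow> effective_domain f \<noteq> {} \<and> (\<forall>z. f z > -\<infinity>)"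

definition ereal_epigraph :: "('a \<Rightarrow> ereal) \<Rightarrow> ('a \<times> real) set"
  where "ereal_epigraph f = {(z, \<alpha>). ereal \<alpha> \<ge> f z}"

definition convex_fun :: "('a::real_vector \<Rightarrow> ereal) \<Rightarrow> bool"
  where "convex_fun f \<longleftrightarrow> convex (ereal_epigraph f)"

definition finite_continuous_at :: "('a::t2_space \<Rightarrow> ereal) \<Rightarrow> 'a \<Rightarrow> bool"
  where "finite_continuous_at f z \<longleftrightarrow> \<bar>f z\<bar> \<noteq> \<infinity> \<and> isCont f z"

text \<open>If \<open>f z0 = -\<infinity>\<close>, the difference below is \<open>\<infinity>\<close> for every \<open>z\<close> by the conventions of
  type \<^typ>\<open>ereal\<close>; this degenerate case is excluded when \<open>f\<close> is proper or finite at \<open>z0\<close>.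
  A point \<open>z\<close> with \<open>f z = -\<infinity>\<close> correctly makes the set empty when \<open>f z0\<close> is finite.\<close>

definition eps_subdifferential ::
    "real \<Rightarrow> ('a::hausdorff_locally_convex_space \<Rightarrow> ereal) \<Rightarrow> 'a \<Rightarrow> ('a \<Rightarrow> real) set"
  where "eps_subdifferential \<epsilon> f z0 =
    (if z0 \<in> effective_domain f
     then {zs \<in> topological_dual. \<forall>z. ereal (zs (z - z0)) \<le> f z - f z0 + ereal \<epsilon>}
     else {})"

definition eps_normals ::
    "real \<Rightarrow> 'a::hausdorff_locally_convex_space \<Rightarrow> 'a set \<Rightarrow> ('a \<Rightarrow> real) set"
  where "eps_normals \<epsilon> z0 C =
    (if z0 \<in> C then {zs \<in> topological_dual. \<forall>z\<in>C. zs (z - z0) \<le> \<epsilon>} else {})"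


section \<open>Multifunctions and the optimal value function\<close>

definition gph :: "('a \<Rightarrow> 'b set) \<Rightarrow> ('a \<times> 'b) set"
  where "gph G = {(x, y). y \<in> G x}"

definition convex_multifunction :: "('a::real_vector \<Rightarrow> 'b::real_vector set) \<Rightarrow> bool"
  where "convex_multifunction G \<longleftrightarrow> convex (gph G)"

definition optimal_value :: "('a \<times> 'b \<Rightarrow> ereal) \<Rightarrow> ('a \<Rightarrow> 'b set) \<Rightarrow> 'a \<Rightarrow> ereal"
  where "optimal_value \<phi> G x = (INF y\<in>G x. \<phi> (x, y))"

definition approx_solutions ::
    "('a \<times> 'b \<Rightarrow> ereal) \<Rightarrow> ('a \<Rightarrow> 'b set) \<Rightarrow> real \<Rightarrow> 'a \<Rightarrow> 'b set"
  where "approx_solutions \<phi> G \<eta> x = {y \<in> G x. \<phi> (x, y) \<le> optimal_value \<phi> G x + ereal \<eta>}"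

definition splittings :: "real \<Rightarrow> (real \<times> real) set"
  where "splittings \<delta> = {(\<gamma>1, \<gamma>2). \<gamma>1 \<ge> 0 \<and> \<gamma>2 \<ge> 0 \<and> \<gamma>1 + \<gamma>2 = \<delta>}"

end

theory Submission
  imports Defs
begin

text \<open>
  Let \<open>C\<close> be the graph of \<open>G\<close>. If \<open>x*\<close> is an \<open>\<epsilon>\<close>-subgradient of the optimal value function \<open>\<mu>\<close> at
  \<open>x0\<close> and \<open>y\<close> is an \<open>\<eta>\<close>-solution at \<open>x0\<close>, replacing \<open>\<mu>(x0)\<close> by \<open>\<phi>(x0, y)\<close> costs at most \<open>\<eta>\<close>, so
  \<open>(x*, 0)\<close> satisfies the \<open>(\<eta> + \<epsilon>)\<close>-subgradient inequality of \<open>\<phi>\<close> at \<open>(x0, y)\<close> for all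
  comparison points in \<open>C\<close>. The approximate sum rule (\<open>approximate_sum_rule\<close>) then splits \<open>(x*, 0)\<close> into
  an approximate subgradient of \<open>\<phi>\<close> and an approximate normal to \<open>C\<close>. Conversely, adding the two
  inequalities of such a splitting and minimising over \<open>G x\<close> bounds \<open>\<mu>(x)\<close> from below with error
  \<open>\<eta> + \<epsilon>\<close>, whichever \<open>y\<close> was used, and \<open>\<eta>\<close> may tend to \<open>0\<close>. Since \<open>\<eta>\<close>-solutions
  exist for every \<open>\<eta> > 0\<close>, the intersection over \<open>\<eta>\<close>-solutions lies in the union over all \<open>y\<close>, and
  the three sets coincide.

  The sum rule is a sandwich argument. Given \<open>h\<close> with \<open>h (z - z0) \<le> f z - f z0 + \<delta>\<close> on \<open>C\<close>,
  put \<open>g z = f z - f z0 - h (z - z0) + \<delta>\<close>, which is nonnegative on \<open>C\<close>, and let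
  \<open>v w\<close> be the infimum of \<open>g z\<close> over all \<open>z\<close> with \<open>z - w \<in> C\<close>. Then \<open>v\<close> is convex with
  \<open>v 0 \<ge> 0\<close>, and either regularity condition bounds \<open>v\<close> above near \<open>0\<close>. Such
  a function has a continuous linear minorant \<open>l\<close> (\<open>continuous_linear_minorant\<close>), that is,
  \<open>l z - l z' \<le> g z\<close> for all \<open>z\<close> and all \<open>z' \<in> C\<close>. Hence \<open>- l\<close> is an approximate normal, \<open>h + l\<close> is an
  approximate subgradient, and the supremum of \<open>- l (z' - z0)\<close> over \<open>z' \<in> C\<close> tells how to divide \<open>\<delta>\<close>.

  The minorant comes from a form of the Hahn--Banach theorem
  (\<open>linear_minorant_of_convex_cone\<close>) that treats epigraphs rather than functions: the cone
  generated by the epigraph of \<open>v\<close> is enlarged to a maximal convex cone that meets the vertical axis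
  only in nonnegative heights, and the lower boundary of the maximal cone is the graph of a linear map.
\<close>

section \<open>Linear minorants of convex cones\<close>

lemma maximal_convex_cone_nonneg_at_0:
  fixes E :: "('v::real_vector \<times> real) set"
  assumes "convex_cone E" and "\<And>r. (0, r) \<in> E \<Longrightarrow> 0 \<le> r"
  obtains M where "E \<subseteq> M" "convex_cone M" "\<And>r. (0, r) \<in> M \<Longrightarrow> 0 \<le> r"
    "\<And>N. convex_cone N \<Longrightarrow> (\<And>r. (0, r) \<in> N \<Longrightarrow> 0 \<le> r) \<Longrightarrow> M \<subseteq> N \<Longrightarrow> N = M"
proof -
  define \<A> where "\<A> = {N. E \<subseteq> N \<and> convex_cone N \<and> (\<forall>r. (0, r) \<in> N \<longrightarrow> 0 \<le> r)}"
  have "\<exists>M\<in>\<A>. \<forall>N\<in>\<A>. M \<subseteq> N \<longrightarrow> N = M"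
  proof (rule subset_Zorn_nonempty)
    show "\<A> \<noteq> {}"
      using assms by (auto simp: \<A>_def)
  next
    fix \<C>
    assume ne: "\<C> \<noteq> {}" and ch: "subset.chain \<A> \<C>"
    then have sub: "\<C> \<subseteq> \<A>"
      by (simp add: subset_chain_def)
    have "x + y \<in> \<Union>\<C>" if xy: "x \<in> \<Union>\<C>" "y \<in> \<Union>\<C>" for x y
    proof -
      obtain A B where AB: "A \<in> \<C>" "B \<in> \<C>" "x \<in> A" "y \<in> B"
        using xy by blast
      obtain N where "N \<in> \<C>" "x \<in> N" "y \<in> N"
        using ch AB unfolding subset_chain_def by blast
      then show ?thesis
        using sub by (auto simp: \<A>_def intro: convex_cone_add)
    qed
    moreover have "0 \<in> \<Union>\<C>"
      using ne sub by (auto simp: \<A>_def dest: convex_cone_contains_0)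
    moreover have "c *\<^sub>R x \<in> \<Union>\<C>" if "x \<in> \<Union>\<C>" "c \<ge> 0" for x c
      using that sub by (auto simp: \<A>_def intro: convex_cone_scaleR)
    ultimately have "convex_cone (\<Union>\<C>)"
      by (simp add: convex_cone_iff del: Union_iff)
    moreover have "E \<subseteq> \<Union>\<C>"
      using ne sub by (auto simp: \<A>_def)
    ultimately show "\<Union>\<C> \<in> \<A>"
      using sub by (auto simp: \<A>_def)
  qed
  then obtain M where "M \<in> \<A>" "\<And>N. N \<in> \<A> \<Longrightarrow> M \<subseteq> N \<Longrightarrow> N = M"
    by blast
  then show thesis
    by (intro that[of M]) (auto simp: \<A>_def)
qed

text \<open>
  With \<open>M\<close> maximal, let \<open>l w\<close> be the infimum of the heights of \<open>M\<close> over \<open>w\<close>; this is sublinear because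
  \<open>M\<close> is a convex cone. Adjoining the ray through \<open>(- y, - l y)\<close> to \<open>M\<close> creates no negative height
  above \<open>0\<close>: if \<open>(t y, r + t l y) \<in> M\<close> with \<open>t > 0\<close>, then \<open>l y\<close> is at most \<open>r / t + l y\<close>. By maximality
  that ray is already in \<open>M\<close>, so \<open>l (- y) \<le> - l y\<close>, and a sublinear map with this property is linear.
\<close>

theorem linear_minorant_of_convex_cone:
  fixes E :: "('v::real_vector \<times> real) set"
  assumes E: "convex_cone E" and E0: "\<And>r. (0, r) \<in> E \<Longrightarrow> 0 \<le> r"
    and fib: "\<And>w. \<exists>r. (w, r) \<in> E"
  obtains l where "linear l" "\<And>w r. (w, r) \<in> E \<Longrightarrow> l w \<le> r"
proof -
  obtain M where EM: "E \<subseteq> M" and M: "convex_cone M" and M0: "\<And>r. (0, r) \<in> M \<Longrightarrow> 0 \<le> r"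
    and max: "\<And>N. convex_cone N \<Longrightarrow> (\<And>r. (0, r) \<in> N \<Longrightarrow> 0 \<le> r) \<Longrightarrow> M \<subseteq> N \<Longrightarrow> N = M"
    using maximal_convex_cone_nonneg_at_0[OF E E0] by blast
  have add: "(x + y, r + s) \<in> M" if "(x, r) \<in> M" "(y, s) \<in> M" for x y r s
    using convex_cone_add[OF M that] by simp
  have scale: "(c *\<^sub>R x, c * r) \<in> M" if "(x, r) \<in> M" "c \<ge> 0" for x c r
    using convex_cone_scaleR[OF M that(2,1)] by simp
  have zero: "(0, 0) \<in> M"
    using convex_cone_contains_0[OF M] by (simp add: zero_prod_def)
  define l where "l w = Inf {r. (w, r) \<in> M}" for w
  have fibM: "\<exists>r. (w, r) \<in> M" for w
    using fib EM by blast
  have bdd: "bdd_below {r. (w, r) \<in> M}" for w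
  proof -
    obtain s where s: "(- w, s) \<in> M"
      using fibM by blast
    have "- s \<le> r" if "(w, r) \<in> M" for r
      using M0[of "r + s"] add[OF that s] by simp
    then show ?thesis
      by (intro bdd_belowI) auto
  qed
  have lower: "l w \<le> r" if "(w, r) \<in> M" for w r
    unfolding l_def using that bdd by (intro cInf_lower) auto
  have neg: "(- y, - l y) \<in> M" for y
  proof -
    \<comment> \<open>the sum of \<open>M\<close> and the ray generated by \<open>(- y, - l y)\<close>\<close>
    define N where "N = {(x, r). \<exists>t\<ge>0. (x + t *\<^sub>R y, r + t * l y) \<in> M}"
    have N_add: "(x, r) + (x', r') \<in> N" if N: "(x, r) \<in> N" "(x', r') \<in> N" for x r x' r'
    proof -
      obtain t t' where t: "t \<ge> 0" "(x + t *\<^sub>R y, r + t * l y) \<in> M"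
        "t' \<ge> 0" "(x' + t' *\<^sub>R y, r' + t' * l y) \<in> M"
        using N by (auto simp: N_def)
      then have "(x + x' + (t + t') *\<^sub>R y, r + r' + (t + t') * l y) \<in> M"
        using add[OF t(2,4)] by (simp add: algebra_simps)
      moreover have "t + t' \<ge> 0"
        using t by simp
      ultimately show ?thesis
        by (auto simp: N_def)
    qed
    have N_scale: "c *\<^sub>R (x, r) \<in> N" if N: "(x, r) \<in> N" and c: "c \<ge> 0" for x r c
    proof -
      obtain t where t: "t \<ge> 0" "(x + t *\<^sub>R y, r + t * l y) \<in> M"
        using N by (auto simp: N_def)
      then have "(c *\<^sub>R x + (c * t) *\<^sub>R y, c * r + (c * t) * l y) \<in> M"
        using scale[OF t(2) c] by (simp add: algebra_simps)
      moreover have "c * t \<ge> 0"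
        using t c by simp
      ultimately show ?thesis
        unfolding N_def by auto
    qed
    have MN: "M \<subseteq> N"
    proof clarify
      fix x r
      assume "(x, r) \<in> M"
      then show "(x, r) \<in> N"
        by (auto simp: N_def intro!: exI[of _ 0])
    qed
    have "convex_cone N"
      using N_add N_scale MN convex_cone_contains_0[OF M] by (auto simp: convex_cone_iff)
    moreover have "0 \<le> r" if r: "(0, r) \<in> N" for r
    proof -
      obtain t where t: "t \<ge> 0" "(t *\<^sub>R y, r + t * l y) \<in> M"
        using r by (auto simp: N_def)
      show ?thesis
      proof (cases "t = 0")
        case True
        then show ?thesis
          using t M0 by simp
      next
        case False
        then have "(y, r / t + l y) \<in> M"
          using scale[OF t(2), of "1 / t"] t(1) by (simp add: field_simps)
        then have "r / t \<ge> 0"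
          using lower by fastforce
        then show ?thesis
          using t(1) False by (simp add: zero_le_divide_iff)
      qed
    qed
    ultimately have "N = M"
      using MN by (intro max)
    moreover have "(- y, - l y) \<in> N"
      using zero by (auto simp: N_def intro!: exI[of _ 1])
    ultimately show ?thesis
      by simp
  qed
  have odd: "l (- y) = - l y" for y
  proof (rule antisym)
    show "l (- y) \<le> - l y"
      using lower[OF neg] .
    have "- r \<le> l (- y)" if "(y, r) \<in> M" for r
      unfolding l_def using fibM M0 add[OF that] by (intro cInf_greatest) force+
    then have "- l (- y) \<le> l y"
      unfolding l_def[of y] using fibM by (intro cInf_greatest) force+
    then show "- l y \<le> l (- y)"
      by simp
  qed
  have graph: "(y, l y) \<in> M" for y
    using neg[of "- y"] by (simp add: odd)
  have sub: "l (x + y) \<le> l x + l y" for x y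
    using lower add graph by blast
  have subscale: "l (c *\<^sub>R x) \<le> c * l x" if "c \<ge> 0" for c x
    using lower scale graph that by blast
  have nonneg: "l (c *\<^sub>R x) = c * l x" if "c \<ge> 0" for c x
    using subscale[OF that, of x] subscale[OF that, of "- x"] by (simp add: odd)
  have "linear l"
  proof (rule linearI)
    show "l (x + y) = l x + l y" for x y
      using sub[of x y] sub[of "- x" "- y"] odd[of "x + y"] by (simp add: odd)
    show "l (c *\<^sub>R x) = c *\<^sub>R l x" for c x
      using nonneg[of c x] nonneg[of "- c" x] by (cases "c \<ge> 0") (auto simp: odd)
  qed
  then show thesis
    using that lower EM by blast
qed


section \<open>Continuous minorants\<close>

lemma tendsto_scaleR_topological:
  fixes g :: "'b \<Rightarrow> 'a::topological_real_vector"
  assumes "(f \<longlongrightarrow> c) F" "(g \<longlongrightarrow> y) F"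
  shows "((\<lambda>x. f x *\<^sub>R g x) \<longlongrightarrow> c *\<^sub>R y) F"
  using filterlim_compose[OF tendsto_scaleR_Pair[of c y], of "\<lambda>x. (f x, g x)" F] assms
  by (simp add: filterlim_Pair)

text \<open>
  On the symmetric neighbourhood \<open>U \<inter> - U\<close> the bound holds for the absolute value of \<open>l\<close>, and shrinking the
  neighbourhood by a factor \<open>k\<close> shrinks the bound by the same factor.
\<close>

lemma linear_bounded_above_near_0_continuous:
  fixes l :: "'a::hausdorff_locally_convex_space \<Rightarrow> real"
  assumes l: "linear l" and U: "open U" "0 \<in> U" and bd: "\<And>w. w \<in> U \<Longrightarrow> l w \<le> m"
  shows "l \<in> topological_dual"
proof -
  have "(l \<longlongrightarrow> l x) (at x)" for x
  proof (rule tendstoI)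
    fix e :: real
    assume e: "e > 0"
    define k where "k = (\<bar>m\<bar> + 1) / e"
    have k: "k > 0"
      using e by (simp add: k_def add_nonneg_pos)
    have near: "eventually (\<lambda>y. c *\<^sub>R (y - x) \<in> U) (at x)" for c
    proof -
      have "((\<lambda>y. c *\<^sub>R (y - x)) \<longlongrightarrow> c *\<^sub>R (x - x)) (at x)"
        by (intro tendsto_scaleR_topological tendsto_intros)
      then show ?thesis
        using U by (auto dest: topological_tendstoD)
    qed
    show "eventually (\<lambda>y. dist (l y) (l x) < e) (at x)"
      using near[of k] near[of "- k"]
    proof eventually_elim
      case (elim y)
      have "k * (l y - l x) \<le> m" "- k * (l y - l x) \<le> m"
        using bd[OF elim(1)] bd[OF elim(2)]
        by (simp_all only: linear_diff[OF l] linear_scale[OF l] real_scaleR_def)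
      then have "\<bar>k * (l y - l x)\<bar> \<le> \<bar>m\<bar>"
        by linarith
      then have "k * \<bar>l y - l x\<bar> \<le> \<bar>m\<bar>"
        using k by (simp add: abs_mult)
      then have "k * \<bar>l y - l x\<bar> < k * e"
        using e by (simp add: k_def)
      then show ?case
        using k by (simp add: dist_real_def)
    qed
  qed
  then show ?thesis
    using l by (auto simp: topological_dual_def continuous_on_def)
qed

text \<open>
  The set \<open>K\<close> plays the role of the epigraph of a convex function that is nonnegative at \<open>0\<close> and at most \<open>m\<close>
  on \<open>U\<close>. Passing to the generated cone keeps the heights above \<open>0\<close> nonnegative; since \<open>U\<close> absorbs
  every vector, this cone has a point above each \<open>w\<close>. The bound on \<open>U\<close> makes the minorant continuous.
\<close>

theorem continuous_linear_minorant:
  fixes K :: "('a::hausdorff_locally_convex_space \<times> real) set"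
  assumes K: "convex K" and K0: "\<And>r. (0, r) \<in> K \<Longrightarrow> 0 \<le> r"
    and U: "open U" "0 \<in> U" and bd: "\<And>w. w \<in> U \<Longrightarrow> (w, m) \<in> K"
  obtains l where "l \<in> topological_dual" "\<And>w r. (w, r) \<in> K \<Longrightarrow> l w \<le> r"
proof -
  have hull: "c *\<^sub>R p \<in> cone hull K" if "p \<in> K" "c \<ge> 0" for c p
    using that by (rule mem_cone_hull)
  have "cone hull K \<noteq> {}"
    using hull[OF bd[OF U(2)], of 1] by auto
  then have "convex_cone (cone hull K)"
    using convex_cone_hull[OF K] cone_cone_hull[of K]
    by (metis conic_def cone_def convex_cone_def)
  moreover have "0 \<le> r" if "(0, r) \<in> cone hull K" for r
  proof -
    obtain c w s where "c \<ge> 0" "(w, s) \<in> K" "0 = c *\<^sub>R w" "r = c * s"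
      using \<open>(0, r) \<in> cone hull K\<close> by (auto simp: cone_hull_expl)
    then show ?thesis
      using K0 by (cases "c = 0") auto
  qed
  moreover have "\<exists>r. (w, r) \<in> cone hull K" for w
  proof -
    have "((\<lambda>c. c *\<^sub>R w) \<longlongrightarrow> 0 *\<^sub>R w) (at_right (0::real))"
      by (intro tendsto_scaleR_topological tendsto_intros)
    then have "eventually (\<lambda>c. c *\<^sub>R w \<in> U) (at_right (0::real))"
      using U by (auto dest: topological_tendstoD)
    then have "eventually (\<lambda>c. c *\<^sub>R w \<in> U \<and> c > 0) (at_right (0::real))"
      by (intro eventually_conj eventually_at_right_less)
    then obtain c :: real where c: "c > 0" "c *\<^sub>R w \<in> U"
      using eventually_happens trivial_limit_at_right_real by blast
    have "(w, m / c) \<in> cone hull K"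
      using hull[OF bd[OF c(2)], of "1 / c"] c(1) by simp
    then show ?thesis ..
  qed
  ultimately obtain l where l: "linear l" "\<And>w r. (w, r) \<in> cone hull K \<Longrightarrow> l w \<le> r"
    using linear_minorant_of_convex_cone by metis
  have le: "l w \<le> r" if "(w, r) \<in> K" for w r
    using l(2) hull[OF that, of 1] by simp
  then have "l \<in> topological_dual"
    using linear_bounded_above_near_0_continuous[OF l(1) U] bd by blast
  then show thesis
    using that le by blast
qed


section \<open>The approximate sum rule\<close>

lemma convex_epigraph_minus_set:
  fixes E :: "('a::real_vector \<times> real) set"
  assumes "convex E" "convex C" "linear h"
  shows "convex {(z - z', s - h z + k) | z s z'. (z, s) \<in> E \<and> z' \<in> C}"
proof -
  define f where "f p = (fst (fst p) - snd p, snd (fst p) - h (fst (fst p)))"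
    for p :: "('a \<times> real) \<times> 'a"
  have "linear f"
    using assms(3) by (auto simp: linear_iff f_def algebra_simps)
  then have "convex ((+) (0, k) ` f ` (E \<times> C))"
    using assms by (intro convex_translation convex_linear_image convex_Times)
  moreover have "(+) (0, k) ` f ` (E \<times> C) = {(z - z', s - h z + k) | z s z'. (z, s) \<in> E \<and> z' \<in> C}"
    by (force simp: f_def image_iff)
  ultimately show ?thesis
    by simp
qed

text \<open>
  This is the nontrivial half of the formula for the \<open>\<delta>\<close>-subdifferential of the sum of \<open>f\<close> and the
  indicator function of \<open>C\<close>: the hypothesis on \<open>h\<close> says that \<open>h\<close> is a \<open>\<delta>\<close>-subgradient of
  that sum at \<open>z0\<close>.
\<close>

theorem approximate_sum_rule:
  fixes f :: "'a::hausdorff_locally_convex_space \<Rightarrow> ereal"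
  assumes pr: "proper_fun f" and cv: "convex_fun f" and C: "convex C"
    and z0: "z0 \<in> C" "z0 \<in> effective_domain f"
    and h: "h \<in> topological_dual"
    and le: "\<And>z. z \<in> C \<Longrightarrow> ereal (h (z - z0)) \<le> f z - f z0 + ereal \<delta>"
    and cq: "interior C \<inter> effective_domain f \<noteq> {} \<or> (\<exists>p\<in>C. finite_continuous_at f p)"
  obtains \<gamma>1 \<gamma>2 where "(\<gamma>1, \<gamma>2) \<in> splittings \<delta>"
    "h \<in> eps_subdifferential \<gamma>1 f z0 + eps_normals \<gamma>2 z0 C"
proof -
  have hl: "linear h" and hc: "continuous_on UNIV h"
    using h by (auto simp: topological_dual_def)
  have real_value: "\<exists>s. f z = ereal s" if "z \<in> effective_domain f" for z
    using pr that by (cases "f z") (auto simp: proper_fun_def effective_domain_def)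
  then obtain r0 where r0: "f z0 = ereal r0"
    using z0 by blast
  \<comment> \<open>\<open>(z, s)\<close> is in the epigraph of \<open>f\<close> iff \<open>(z, s - h z + k)\<close> is in the epigraph of
      \<open>g z = f z - f z0 - h (z - z0) + \<delta>\<close>, and the hypothesis on \<open>h\<close> says that \<open>g\<close> is nonnegative on \<open>C\<close>\<close>
  define k where "k = h z0 - r0 + \<delta>"
  define K where
    "K = {(z - z', s - h z + k) | z s z'. (z, s) \<in> ereal_epigraph f \<and> z' \<in> C}"
  have K_I: "(z - z', s - h z + k) \<in> K" if "f z \<le> ereal s" "z' \<in> C" for z z' s
    using that by (auto simp: K_def ereal_epigraph_def)
  have "convex K"
    unfolding K_def using cv C hl by (intro convex_epigraph_minus_set) (auto simp: convex_fun_def)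
  moreover have "0 \<le> r" if K: "(0, r) \<in> K" for r
  proof -
    obtain z s z' where zs: "f z \<le> ereal s" "z' \<in> C" and "0 = z - z'" and r: "r = s - h z + k"
      using K unfolding K_def ereal_epigraph_def by blast
    then have "z \<in> C"
      by simp
    have "ereal (h (z - z0)) \<le> ereal s - ereal r0 + ereal \<delta>"
      using le[OF \<open>z \<in> C\<close>] zs(1) r0
      by (metis add_mono ereal_minus_mono order_refl order_trans)
    then show ?thesis
      by (simp add: r k_def linear_diff[OF hl])
  qed
  moreover have "\<exists>U m. open U \<and> 0 \<in> U \<and> (\<forall>w\<in>U. (w, m) \<in> K)"
    using cq
  proof
    assume "interior C \<inter> effective_domain f \<noteq> {}"
    \<comment> \<open>\<open>w = p - (p - w)\<close>: keep \<open>z = p\<close> fixed and let \<open>z' = p - w\<close> vary in the interior of \<open>C\<close>\<close>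
    then obtain p s where p: "p \<in> interior C" "f p = ereal s"
      using real_value by blast
    have "open ((\<lambda>w. p - w) -` interior C)"
      by (intro open_vimage continuous_intros open_interior)
    moreover have "(w, s - h p + k) \<in> K" if "p - w \<in> interior C" for w
      using K_I[of p s "p - w"] p that interior_subset by auto
    ultimately show ?thesis
      using p(1) by (intro exI[of _ "(\<lambda>w. p - w) -` interior C"] exI[of _ "s - h p + k"]) auto
  next
    assume "\<exists>p\<in>C. finite_continuous_at f p"
    \<comment> \<open>\<open>w = (p + w) - p\<close>: keep \<open>z' = p\<close> fixed and let \<open>z = p + w\<close> vary; near \<open>p\<close> both \<open>f\<close> and \<open>- h\<close>
        exceed their values at \<open>p\<close> by at most \<open>1\<close>, whence the \<open>2\<close> in the common bound\<close>
    then obtain p s where p: "p \<in> C" "f p = ereal s" "isCont f p"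
      by (auto simp: finite_continuous_at_def)
    have "(f \<longlongrightarrow> f p) (nhds p)"
      using p(3) by (simp add: isCont_def tendsto_at_iff_tendsto_nhds)
    then have "eventually (\<lambda>z. f z < ereal (s + 1)) (nhds p)"
      by (rule order_tendstoD) (simp add: p(2))
    moreover have "(h \<longlongrightarrow> h p) (nhds p)"
      using hc by (simp add: continuous_on_eq_continuous_at isCont_def tendsto_at_iff_tendsto_nhds)
    then have "eventually (\<lambda>z. h z > h p - 1) (nhds p)"
      by (rule order_tendstoD) simp
    ultimately have "eventually (\<lambda>z. f z < ereal (s + 1) \<and> h z > h p - 1) (nhds p)"
      by (rule eventually_conj)
    then obtain V where V: "open V" "p \<in> V" "\<And>z. z \<in> V \<Longrightarrow> f z < ereal (s + 1)"
      "\<And>z. z \<in> V \<Longrightarrow> h z > h p - 1"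
      by (auto simp: eventually_nhds)
    have "open ((\<lambda>w. p + w) -` V)"
      by (intro open_vimage continuous_intros V)
    moreover have "(w, s + 2 - h p + k) \<in> K" if w: "p + w \<in> V" for w
    proof -
      have "ereal (s + 1) \<le> ereal (s + 2 + h (p + w) - h p)"
        using V(4)[OF w] by simp
      then have "f (p + w) \<le> ereal (s + 2 + h (p + w) - h p)"
        using V(3)[OF w] by (meson less_imp_le order_trans)
      from K_I[OF this p(1)] show ?thesis
        by (simp add: algebra_simps)
    qed
    ultimately show ?thesis
      using V(2) by (intro exI[of _ "(\<lambda>w. p + w) -` V"] exI[of _ "s + 2 - h p + k"]) auto
  qed
  ultimately obtain l where l: "l \<in> topological_dual" and lK: "\<And>w r. (w, r) \<in> K \<Longrightarrow> l w \<le> r"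
    using continuous_linear_minorant by metis
  have ll: "linear l" and lc: "continuous_on UNIV l"
    using l by (auto simp: topological_dual_def)
  have sandwich: "- l (z' - z0) \<le> s - r0 + \<delta> - (h (z - z0) + l (z - z0))"
    if "f z \<le> ereal s" "z' \<in> C" for z z' s
    using lK[OF K_I[OF that]] by (simp add: k_def linear_diff[OF ll] linear_diff[OF hl])
  \<comment> \<open>the least \<open>\<gamma>\<close> for which \<open>- l\<close> is a \<open>\<gamma>\<close>-normal; by \<open>sandwich\<close>, the remainder \<open>\<delta> - \<gamma>\<close>
      is enough for \<open>h + l\<close>\<close>
  define \<gamma> where "\<gamma> = (SUP z'\<in>C. - l (z' - z0))"
  have \<gamma>_least: "\<gamma> \<le> s - r0 + \<delta> - (h (z - z0) + l (z - z0))" if "f z \<le> ereal s" for z s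
    unfolding \<gamma>_def using z0 sandwich[OF that] by (intro cSUP_least) auto
  have bdd: "bdd_above ((\<lambda>z'. - l (z' - z0)) ` C)"
    using sandwich[of z0 r0] r0 by (intro bdd_aboveI2) auto
  have \<gamma>_upper: "- l (z' - z0) \<le> \<gamma>" if "z' \<in> C" for z'
    unfolding \<gamma>_def using bdd that by (intro cSUP_upper)
  have "\<gamma> \<ge> 0" "\<gamma> \<le> \<delta>"
    using \<gamma>_upper[OF z0(1)] \<gamma>_least[of z0 r0] r0
    by (simp_all add: linear_0[OF ll] linear_0[OF hl])
  then have "(\<delta> - \<gamma>, \<gamma>) \<in> splittings \<delta>"
    by (simp add: splittings_def)
  moreover have "h + l \<in> eps_subdifferential (\<delta> - \<gamma>) f z0"
  proof -
    have "h + l \<in> topological_dual"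
      using hl ll hc lc by (auto simp: topological_dual_def plus_fun_def linear_compose_add intro!: continuous_intros)
    moreover have "ereal ((h + l) (z - z0)) \<le> f z - f z0 + ereal (\<delta> - \<gamma>)" for z
    proof (cases "f z")
      case (real s)
      then show ?thesis
        using \<gamma>_least[of z s] by (simp add: r0)
    qed (use pr r0 in \<open>auto simp: proper_fun_def\<close>)
    ultimately show ?thesis
      using z0 by (simp add: eps_subdifferential_def)
  qed
  moreover have "- l \<in> eps_normals \<gamma> z0 C"
  proof -
    have "- l \<in> topological_dual"
      using ll lc by (auto simp: topological_dual_def fun_Compl_def linear_compose_neg intro!: continuous_intros)
    then show ?thesis
      using z0 \<gamma>_upper by (simp add: eps_normals_def)
  qed
  then have "(h + l) + - l \<in> eps_subdifferential (\<delta> - \<gamma>) f z0 + eps_normals \<gamma> z0 C"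
    using calculation by (intro set_plus_intro)
  ultimately show thesis
    by (intro that[of "\<delta> - \<gamma>" \<gamma>]) (simp_all add: algebra_simps)
qed


section \<open>The optimal value function\<close>

lemma dual_pair_0_in_topological_dual:
  assumes "xs \<in> topological_dual"
  shows "dual_pair xs 0 \<in> topological_dual"
proof -
  have "0 \<in> topological_dual"
    by (simp add: topological_dual_def linear_zero zero_fun_def)
  then show ?thesis
    using assms bij_betw_apply[OF bij_betw_dual_pair, of "(xs, 0)"] by simp
qed

lemma approx_solutions_nonempty:
  assumes "\<bar>optimal_value \<phi> G x0\<bar> \<noteq> \<infinity>" "\<eta> > 0"
  shows "approx_solutions \<phi> G \<eta> x0 \<noteq> {}"
proof -
  have "optimal_value \<phi> G x0 < optimal_value \<phi> G x0 + ereal \<eta>"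
    using assms by (cases "optimal_value \<phi> G x0") auto
  then obtain y where "y \<in> G x0" "\<phi> (x0, y) < optimal_value \<phi> G x0 + ereal \<eta>"
    by (subst (asm) (1) optimal_value_def) (auto simp: INF_less_iff)
  then show ?thesis
    by (auto simp: approx_solutions_def intro: less_imp_le)
qed

text \<open>
  On the graph of \<open>G\<close> the value function lies below \<open>\<phi>\<close>, and at \<open>x0\<close> it is within \<open>\<eta>\<close> of \<open>\<phi> (x0, y)\<close>; so the
  subgradient inequality for the value function becomes, with error \<open>\<eta> + \<epsilon>\<close>, the one that the sum rule
  needs.
\<close>

lemma subgradient_of_optimal_value_splits:
  fixes \<phi> :: "'x::hausdorff_locally_convex_space \<times> 'y::hausdorff_locally_convex_space \<Rightarrow> ereal"
  assumes pr: "proper_fun \<phi>" and cv: "convex_fun \<phi>" and G: "convex_multifunction G"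
    and fin: "\<bar>optimal_value \<phi> G x0\<bar> \<noteq> \<infinity>"
    and cq: "interior (gph G) \<inter> effective_domain \<phi> \<noteq> {} \<or> (\<exists>p\<in>gph G. finite_continuous_at \<phi> p)"
    and xs: "xs \<in> eps_subdifferential \<epsilon> (optimal_value \<phi> G) x0"
    and y: "y \<in> approx_solutions \<phi> G \<eta> x0"
  obtains \<gamma>1 \<gamma>2 where "(\<gamma>1, \<gamma>2) \<in> splittings (\<eta> + \<epsilon>)"
    "dual_pair xs 0 \<in> eps_subdifferential \<gamma>1 \<phi> (x0, y) + eps_normals \<gamma>2 (x0, y) (gph G)"
proof -
  obtain m where m: "optimal_value \<phi> G x0 = ereal m"
    using fin by auto
  have xd: "xs \<in> topological_dual"
    and sub: "\<And>x. ereal (xs (x - x0)) \<le> optimal_value \<phi> G x - ereal m + ereal \<epsilon>"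
    using xs m by (auto simp: eps_subdifferential_def split: if_splits)
  have yG: "y \<in> G x0" and "\<phi> (x0, y) \<le> ereal (m + \<eta>)"
    using y by (auto simp: approx_solutions_def m)
  moreover have ninf: "\<phi> p > -\<infinity>" for p
    using pr unfolding proper_fun_def by blast
  ultimately obtain r where r: "\<phi> (x0, y) = ereal r" "r \<le> m + \<eta>"
    by (cases "\<phi> (x0, y)") (use ninf[of "(x0, y)"] in auto)
  have le: "ereal (dual_pair xs 0 (z - (x0, y))) \<le> \<phi> z - \<phi> (x0, y) + ereal (\<eta> + \<epsilon>)"
    if z: "z \<in> gph G" for z
  proof -
    obtain x v where z: "z = (x, v)" "v \<in> G x"
      using z by (auto simp: gph_def)
    have "optimal_value \<phi> G x \<le> \<phi> z"
      using z by (auto simp: optimal_value_def intro: INF_lower)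
    then have *: "ereal (xs (x - x0)) \<le> \<phi> z - ereal m + ereal \<epsilon>"
      using sub[of x] by (meson add_mono ereal_minus_mono order_refl order_trans)
    show ?thesis
    proof (cases "\<phi> z")
      case (real s)
      then show ?thesis
        using * r by (simp add: z dual_pair_def)
    qed (use ninf[of z] r in auto)
  qed
  show thesis
  proof (rule approximate_sum_rule[OF pr cv _ _ _ _ le cq])
    show "convex (gph G)"
      using G by (simp add: convex_multifunction_def)
    show "(x0, y) \<in> gph G"
      using yG by (simp add: gph_def)
    show "(x0, y) \<in> effective_domain \<phi>"
      by (simp add: effective_domain_def r)
    show "dual_pair xs 0 \<in> topological_dual"
      using xd by (rule dual_pair_0_in_topological_dual)
  qed (blast intro: that)+
qed

text \<open>
  Adding the subgradient and the normal inequality gives the bound for \<open>\<phi> (x, v)\<close>, \<open>v \<in> G x\<close>, with \<open>\<phi> (x0, y)\<close>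
  in place of \<open>m\<close>. The normal set is nonempty only if \<open>y \<in> G x0\<close>, and then \<open>m \<le> \<phi> (x0, y)\<close>.
\<close>

lemma split_subgradient_bounds_optimal_value:
  fixes \<phi> :: "'x::hausdorff_locally_convex_space \<times> 'y::hausdorff_locally_convex_space \<Rightarrow> ereal"
  assumes pr: "proper_fun \<phi>" and m: "optimal_value \<phi> G x0 = ereal m"
    and split: "(\<gamma>1, \<gamma>2) \<in> splittings \<delta>"
    and mem: "dual_pair xs 0 \<in> eps_subdifferential \<gamma>1 \<phi> (x0, y) + eps_normals \<gamma>2 (x0, y) (gph G)"
  shows "ereal (xs (x - x0) + m - \<delta>) \<le> optimal_value \<phi> G x"
proof -
  obtain a b where a: "a \<in> eps_subdifferential \<gamma>1 \<phi> (x0, y)"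
    and b: "b \<in> eps_normals \<gamma>2 (x0, y) (gph G)" and ab: "dual_pair xs 0 = a + b"
    using mem by (auto elim: set_plus_elim)
  have dom: "\<phi> (x0, y) < \<infinity>"
    and a': "\<And>z. ereal (a (z - (x0, y))) \<le> \<phi> z - \<phi> (x0, y) + ereal \<gamma>1"
    using a by (auto simp: eps_subdifferential_def effective_domain_def split: if_splits)
  have yG: "y \<in> G x0" and b': "\<And>z. z \<in> gph G \<Longrightarrow> b (z - (x0, y)) \<le> \<gamma>2"
    using b by (auto simp: eps_normals_def gph_def split: if_splits)
  have ninf: "\<phi> p > -\<infinity>" for p
    using pr unfolding proper_fun_def by blast
  obtain r where r: "\<phi> (x0, y) = ereal r"
    using dom ninf[of "(x0, y)"] by (cases "\<phi> (x0, y)") auto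
  have mr: "m \<le> r"
    using INF_lower[OF yG, of "\<lambda>y. \<phi> (x0, y)"] m r by (simp add: optimal_value_def)
  show ?thesis
    unfolding optimal_value_def
  proof (rule INF_greatest)
    fix v
    assume v: "v \<in> G x"
    show "ereal (xs (x - x0) + m - \<delta>) \<le> \<phi> (x, v)"
    proof (cases "\<phi> (x, v)")
      case (real s)
      have "xs (x - x0) = a ((x, v) - (x0, y)) + b ((x, v) - (x0, y))"
        using fun_cong[OF ab, of "(x, v) - (x0, y)"] by (simp add: dual_pair_def)
      moreover have "a ((x, v) - (x0, y)) \<le> s - r + \<gamma>1"
        using a'[of "(x, v)"] by (simp add: real r)
      moreover have "b ((x, v) - (x0, y)) \<le> \<gamma>2"
        using v by (intro b') (simp add: gph_def)
      ultimately show ?thesis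
        using mr split by (simp add: real splittings_def)
    qed (use ninf[of "(x, v)"] in auto)
  qed
qed

lemma subgradient_of_optimal_value_if_splits:
  fixes \<phi> :: "'x::hausdorff_locally_convex_space \<times> 'y::hausdorff_locally_convex_space \<Rightarrow> ereal"
  assumes pr: "proper_fun \<phi>" and fin: "\<bar>optimal_value \<phi> G x0\<bar> \<noteq> \<infinity>"
    and xs: "xs \<in> topological_dual"
    and ex: "\<And>\<eta>. \<eta> > 0 \<Longrightarrow> \<exists>y. \<exists>(\<gamma>1, \<gamma>2)\<in>splittings (\<eta> + \<epsilon>).
       dual_pair xs 0 \<in> eps_subdifferential \<gamma>1 \<phi> (x0, y) + eps_normals \<gamma>2 (x0, y) (gph G)"
  shows "xs \<in> eps_subdifferential \<epsilon> (optimal_value \<phi> G) x0"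
proof -
  obtain m where m: "optimal_value \<phi> G x0 = ereal m"
    using fin by auto
  have bound: "ereal (xs (x - x0) + m - (\<eta> + \<epsilon>)) \<le> optimal_value \<phi> G x" if "\<eta> > 0" for \<eta> x
    using ex[OF that] split_subgradient_bounds_optimal_value[OF pr m] by fastforce
  have "ereal (xs (x - x0)) \<le> optimal_value \<phi> G x - ereal m + ereal \<epsilon>" for x
  proof (cases "optimal_value \<phi> G x")
    case (real s)
    have "xs (x - x0) + m - \<epsilon> \<le> s"
    proof (rule field_le_epsilon)
      fix \<eta> :: real
      assume "\<eta> > 0"
      then show "xs (x - x0) + m - \<epsilon> \<le> s + \<eta>"
        using bound[of \<eta> x] real by simp
    qed
    then show ?thesis
      by (simp add: real)
  qed (use bound[of 1 x] in auto)
  then show ?thesis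
    using xs m by (simp add: eps_subdifferential_def effective_domain_def)
qed

theorem theorem4p2:
  fixes \<phi> :: "'x::hausdorff_locally_convex_space \<times> 'y::hausdorff_locally_convex_space \<Rightarrow> ereal"
    and G :: "'x \<Rightarrow> 'y set"
    and x0 :: 'x
  assumes "proper_fun \<phi>" and "convex_fun \<phi>"
    and "convex_multifunction G"
    and "\<bar>optimal_value \<phi> G x0\<bar> \<noteq> \<infinity>"
    and "interior (gph G) \<inter> effective_domain \<phi> \<noteq> {} \<or>
         (\<exists>p\<in>gph G. finite_continuous_at \<phi> p)"
  shows "\<forall>\<epsilon>::real. \<epsilon> \<ge> 0 \<longrightarrow>
     eps_subdifferential \<epsilon> (optimal_value \<phi> G) x0 =
       (\<Inter>\<eta>\<in>{0<..}. \<Inter>y\<in>approx_solutions \<phi> G \<eta> x0. \<Union>(\<gamma>1, \<gamma>2)\<in>splittings (\<eta> + \<epsilon>).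
          {xs \<in> topological_dual.
            dual_pair xs 0 \<in>
              eps_subdifferential \<gamma>1 \<phi> (x0, y) + eps_normals \<gamma>2 (x0, y) (gph G)}) \<and>
     eps_subdifferential \<epsilon> (optimal_value \<phi> G) x0 =
       (\<Inter>\<eta>\<in>{0<..}. \<Union>y\<in>UNIV. \<Union>(\<gamma>1, \<gamma>2)\<in>splittings (\<eta> + \<epsilon>).
          {xs \<in> topological_dual.
            dual_pair xs 0 \<in>
              eps_subdifferential \<gamma>1 \<phi> (x0, y) + eps_normals \<gamma>2 (x0, y) (gph G)})"
proof (intro allI impI)
  fix \<epsilon> :: real
  let ?S = "eps_subdifferential \<epsilon> (optimal_value \<phi> G) x0"
  define F where "F \<eta> y = (\<Union>(\<gamma>1, \<gamma>2)\<in>splittings (\<eta> + \<epsilon>).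
    {xs \<in> topological_dual.
      dual_pair xs 0 \<in> eps_subdifferential \<gamma>1 \<phi> (x0, y) + eps_normals \<gamma>2 (x0, y) (gph G)})"
    for \<eta> y
  have F_iff: "xs \<in> F \<eta> y \<longleftrightarrow> xs \<in> topological_dual \<and> (\<exists>(\<gamma>1, \<gamma>2)\<in>splittings (\<eta> + \<epsilon>).
      dual_pair xs 0 \<in> eps_subdifferential \<gamma>1 \<phi> (x0, y) + eps_normals \<gamma>2 (x0, y) (gph G))"
    for xs \<eta> y
    by (auto simp: F_def)
  have S_F: "?S \<subseteq> (\<Inter>\<eta>\<in>{0<..}. \<Inter>y\<in>approx_solutions \<phi> G \<eta> x0. F \<eta> y)"
  proof (intro subsetI INT_I)
    fix xs \<eta> y
    assume xs: "xs \<in> ?S" and y: "y \<in> approx_solutions \<phi> G \<eta> x0"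
    have "xs \<in> topological_dual"
      using xs by (simp add: eps_subdifferential_def split: if_splits)
    moreover obtain \<gamma>1 \<gamma>2 where "(\<gamma>1, \<gamma>2) \<in> splittings (\<eta> + \<epsilon>)"
      "dual_pair xs 0 \<in> eps_subdifferential \<gamma>1 \<phi> (x0, y) + eps_normals \<gamma>2 (x0, y) (gph G)"
      by (rule subgradient_of_optimal_value_splits[OF assms xs y])
    ultimately show "xs \<in> F \<eta> y"
      unfolding F_iff by blast
  qed
  have F_F: "(\<Inter>\<eta>\<in>{0<..}. \<Inter>y\<in>approx_solutions \<phi> G \<eta> x0. F \<eta> y)
      \<subseteq> (\<Inter>\<eta>\<in>{0<..}. \<Union>y\<in>UNIV. F \<eta> y)"
    using approx_solutions_nonempty[OF assms(4)] by fast
  have F_S: "(\<Inter>\<eta>\<in>{0<..}. \<Union>y\<in>UNIV. F \<eta> y) \<subseteq> ?S"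
  proof
    fix xs
    assume xs: "xs \<in> (\<Inter>\<eta>\<in>{0<..}. \<Union>y\<in>UNIV. F \<eta> y)"
    have "xs \<in> (\<Union>y\<in>UNIV. F 1 y)"
      using xs by (rule INT_D) simp
    then have "xs \<in> topological_dual"
      by (auto simp: F_iff)
    then show "xs \<in> ?S"
    proof (rule subgradient_of_optimal_value_if_splits[OF assms(1,4)])
      fix \<eta> :: real
      assume "\<eta> > 0"
      then have "xs \<in> (\<Union>y\<in>UNIV. F \<eta> y)"
        by (intro INT_D[OF xs]) simp
      then show "\<exists>y. \<exists>(\<gamma>1, \<gamma>2)\<in>splittings (\<eta> + \<epsilon>).
          dual_pair xs 0 \<in> eps_subdifferential \<gamma>1 \<phi> (x0, y) + eps_normals \<gamma>2 (x0, y) (gph G)"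
        unfolding UN_iff F_iff by blast
    qed
  qed
  have "?S = (\<Inter>\<eta>\<in>{0<..}. \<Inter>y\<in>approx_solutions \<phi> G \<eta> x0. F \<eta> y)"
    using S_F F_F F_S by (meson antisym order_trans)
  moreover have "?S = (\<Inter>\<eta>\<in>{0<..}. \<Union>y\<in>UNIV. F \<eta> y)"
    using S_F F_F F_S by (meson antisym order_trans)
  ultimately show "?S = (\<Inter>\<eta>\<in>{0<..}. \<Inter>y\<in>approx_solutions \<phi> G \<eta> x0.
        \<Union>(\<gamma>1, \<gamma>2)\<in>splittings (\<eta> + \<epsilon>). {xs \<in> topological_dual.
          dual_pair xs 0 \<in> eps_subdifferential \<gamma>1 \<phi> (x0, y) + eps_normals \<gamma>2 (x0, y) (gph G)}) \<and>
      ?S = (\<Inter>\<eta>\<in>{0<..}. \<Union>y\<in>UNIV. \<Union>(\<gamma>1, \<gamma>2)\<in>splittings (\<eta> + \<epsilon>). {xs \<in> topological_dual.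
          dual_pair xs 0 \<in> eps_subdifferential \<gamma>1 \<phi> (x0, y) + eps_normals \<gamma>2 (x0, y) (gph G)})"
    unfolding F_def by (rule conjI)
qed

end
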